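(* Let $p$ be a prime and let $h, r$ be integers with $h = mr + \epsilon$, where $m \geq 0$ and $0 \leq \epsilon \leq r-1$ are integers. Let $A \subseteq \mathbb{Z}/p\mathbb{Z}$ be a nonempty set with $|A| = k$ such that $1 \leq r \leq h \leq rk$. Then $$|h^{(r)} A| \geq \min\left(p,\; hk - m^2 r + 1 - 2m\epsilon - \epsilon\right).$$
   Context: For a finite set $A = \{a_1, \dots, a_k\}$ of $k$ distinct elements of an abelian group $G$ and integers $h, r \geq 1$, the generalized $h$-fold sumset is $$h^{(r)} A = \left\{ \sum_{i=1}^k r_i a_i : 0 \leq r_i \leq r \text{ for } i = 1, \dots, k \text{ and } \sum_{i=1}^k r_i = h \right\},$$ i.e. the set of sums of $h$ elements of $A$ in which each element of $A$ appears at most $r$ times. *)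

theory Defs
  imports "HOL-Number_Theory.Residues"
begin

(* The abelian group G is written additively and given, as for the locale abelian_group,
   by the additive part of a ring record. The value c a is the multiplicity r_i of a = a_i.
   Meaningful for finite A contained in carrier G. *)
definition gen_sumset :: "('a, 'b) ring_scheme \<Rightarrow> nat \<Rightarrow> nat \<Rightarrow> 'a set \<Rightarrow> 'a set" where
  "gen_sumset G h r A =
    {(\<Oplus>\<^bsub>G\<^esub>a\<in>A. [c a] \<cdot>\<^bsub>G\<^esub> a) | c :: 'a \<Rightarrow> nat.
      (\<forall>a\<in>A. c a \<le> r) \<and> (\<Sum>a\<in>A. c a) = h}"

end

theory Submission
  imports Defs "Jordan_Normal_Form.Determinant"
begin

text \<open>
  Writing \<open>h = \<epsilon> (m + 1) + (r - \<epsilon>) m\<close>, the set \<open>h\<^sup>(\<^sup>r\<^sup>)A\<close> contains every sum of \<open>\<epsilon>\<close> subset sums of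
  \<open>(m + 1)\<close>-element subsets of \<open>A\<close> and \<open>r - \<epsilon>\<close> subset sums of \<open>m\<close>-element subsets. The bound is what
  the Dias da Silva--Hamidoune theorem for each summand and the Cauchy--Davenport theorem for their
  sum give.

  Both theorems come from one instance of the polynomial method. Let \<open>B\<^sub>i\<close> have \<open>c\<^sub>i + 1\<close> elements and
  carry weights that annihilate the powers below \<open>c\<^sub>i\<close> modulo \<open>p\<close>. Weighted summation over \<open>\<Prod>B\<^sub>i\<close>
  extracts the coefficient of \<open>\<Prod>x\<^sub>i ^ c\<^sub>i\<close> from a polynomial of degree at most \<open>\<Sum>c\<^sub>i\<close>. Apply it to
  \<open>G(x) \<Prod>\<^sub>s\<^sub>\<in>\<^sub>R (\<Sum>x\<^sub>i - s)\<close>, where \<open>R\<close> would be a too small set of sums, with \<open>G = 1\<close> for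
  Cauchy--Davenport and \<open>G\<close> the Vandermonde determinant for Dias da Silva--Hamidoune: the polynomial
  vanishes at every point, while its coefficient does not vanish modulo \<open>p\<close>.
\<close>

section \<open>Falling factorials and interpolation weights modulo p\<close>

text \<open>Equal to n!/(n-j)! for j \<le> n; beyond that the factor at l = n makes it 0.\<close>

definition falling :: "nat \<Rightarrow> nat \<Rightarrow> int" where
  "falling n j = (\<Prod>l<j. int n - int l)"

lemma falling_0 [simp]: "falling n 0 = 1"
  by (simp add: falling_def)

lemma falling_Suc: "falling n (Suc j) = falling n j * (int n - int j)"
  by (simp add: falling_def)

lemma falling_eq_0: "n < j \<Longrightarrow> falling n j = 0"
  by (auto simp: falling_def)

lemma falling_self: "falling n n = fact n"
proof -
  have "falling n n = (\<Prod>l<n. int (n - l))"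
    unfolding falling_def by (intro prod.cong) auto
  also have "\<dots> = (\<Prod>l<n. int (Suc l))"
    by (subst prod.nat_diff_reindex [symmetric]) (intro prod.cong, auto)
  also have "\<dots> = fact n"
    by (induct n) (auto simp: algebra_simps)
  finally show ?thesis .
qed

text \<open>The weights are those of the divided difference at the nodes \<open>B\<close>, which
  kills powers below c and sends b^c to 1. They exist modulo p because distinct nodes in {0..<p}
  have invertible differences.\<close>

lemma interpolation_weights:
  fixes p :: nat and B :: "int set"
  assumes p: "prime p" and "B \<subseteq> {0..<int p}" and "card B = Suc c"
  shows "\<exists>w. \<forall>j\<le>c. [(\<Sum>b\<in>B. w b * b ^ j) = (if j = c then 1 else 0)] (mod int p)"
  using assms(2,3)
proof (induction c arbitrary: B)
  case 0
  then obtain b where "B = {b}" by (auto simp: card_1_singleton_iff)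
  then show ?case by (intro exI[of _ "\<lambda>_. 1"]) auto
next
  case (Suc c)
  obtain z B0 where B: "B = insert z B0" "z \<notin> B0" and cB0: "card B0 = Suc c"
    using Suc.prems(2) by (metis card_eq_SucD)
  have fin: "finite B0" using cB0 by (simp add: card_ge_0_finite)
  have "B0 \<subseteq> {0..<int p}" using Suc.prems B by auto
  from Suc.IH[OF this cB0] obtain w where
    w: "\<And>j. j \<le> c \<Longrightarrow> [(\<Sum>b\<in>B0. w b * b ^ j) = (if j = c then 1 else 0)] (mod int p)" by blast
  have "\<exists>v. [(b - z) * v = 1] (mod int p)" if "b \<in> B0" for b
  proof (rule cong_solve_coprime_int)
    have "b \<in> {0..<int p}" "z \<in> {0..<int p}" "b \<noteq> z" using that B Suc.prems by auto
    then have "b \<noteq> z" "\<bar>b - z\<bar> < int p" by auto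
    then have "\<not> int p dvd b - z" using zdvd_imp_le[of "int p" "\<bar>b - z\<bar>"] by auto
    then show "coprime (b - z) (int p)"
      using p prime_imp_coprime[of "int p" "b - z"] by (simp add: coprime_commute)
  qed
  then obtain v where v: "\<And>b. b \<in> B0 \<Longrightarrow> [(b - z) * v b = 1] (mod int p)" by metis
  \<comment> \<open>Dividing the old weights by b - z makes S (j+1) - z * S j the old sum for b^j
    modulo p; the weight at z is forced by S 0 = 0.\<close>
  define u where "u b = (if b = z then - (\<Sum>b\<in>B0. w b * v b) else w b * v b)" for b
  define S where "S j = (\<Sum>b\<in>B. u b * b ^ j)" for j
  have S: "S j = (\<Sum>b\<in>B0. w b * v b * b ^ j) - (\<Sum>b\<in>B0. w b * v b) * z ^ j" for j
  proof -
    have "(\<Sum>b\<in>B0. u b * b ^ j) = (\<Sum>b\<in>B0. w b * v b * b ^ j)"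
      using B by (intro sum.cong) (auto simp: u_def)
    then show ?thesis using B fin by (simp add: S_def u_def)
  qed
  have step: "[S (Suc j) = z * S j + (\<Sum>b\<in>B0. w b * b ^ j)] (mod int p)" for j
  proof -
    have "S (Suc j) = z * S j + (\<Sum>b\<in>B0. w b * b ^ j * ((b - z) * v b))"
      unfolding S by (simp add: algebra_simps sum_distrib_left sum_subtractf)
    moreover have "[(\<Sum>b\<in>B0. w b * b ^ j * ((b - z) * v b)) = (\<Sum>b\<in>B0. w b * b ^ j * 1)] (mod int p)"
      by (intro cong_sum cong_mult cong_refl v)
    ultimately show ?thesis by (simp add: cong_add_lcancel)
  qed
  have "[S j = (if j = Suc c then 1 else 0)] (mod int p)" if "j \<le> Suc c" for j
    using that
  proof (induction j)
    case 0
    then show ?case by (simp add: S)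
  next
    case (Suc j)
    have "[z * S j + (\<Sum>b\<in>B0. w b * b ^ j) = z * 0 + (if j = c then 1 else 0)] (mod int p)"
      using Suc w[of j] by (intro cong_add cong_mult cong_refl) auto
    from cong_trans[OF step this] show ?case by simp
  qed
  then show ?case unfolding S_def by blast
qed

section \<open>Coefficient extraction over a grid\<close>

text \<open>
  Multiplying by \<open>\<Prod>c\<^sub>i!\<close> turns the multinomial coefficient \<open>t! / \<Prod>(c\<^sub>i - e\<^sub>i)!\<close> of the expansion into an
  integer expression that is automatically zero if some \<open>e\<^sub>i > c\<^sub>i\<close>.
\<close>
lemma weighted_monomial_sum:
  fixes B :: "'i \<Rightarrow> int set" and w :: "'i \<Rightarrow> int \<Rightarrow> int" and q :: int
  assumes fI: "finite I" and fB: "\<And>i. i \<in> I \<Longrightarrow> finite (B i)"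
    and w: "\<And>i j. i \<in> I \<Longrightarrow> j \<le> c i \<Longrightarrow>
      [(\<Sum>b\<in>B i. w i b * b ^ j) = (if j = c i then 1 else 0)] (mod q)"
    and "t + sum e I \<le> sum c I"
  shows "[(\<Sum>x\<in>PiE I B. (\<Prod>i\<in>I. w i (x i) * x i ^ e i) * (\<Sum>i\<in>I. x i) ^ t) * (\<Prod>i\<in>I. fact (c i))
    = (if t + sum e I = sum c I then fact t * (\<Prod>i\<in>I. falling (c i) (e i)) else 0)] (mod q)"
  using assms(4)
proof (induction t arbitrary: e)
  case 0
  have T: "(\<Sum>x\<in>PiE I B. (\<Prod>i\<in>I. w i (x i) * x i ^ e i) * (\<Sum>i\<in>I. x i) ^ 0)
      = (\<Prod>i\<in>I. \<Sum>b\<in>B i. w i b * b ^ e i)"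
    using fI fB by (simp add: prod_sum_PiE)
  show ?case
  proof (cases "\<forall>i\<in>I. e i = c i")
    case True
    have "[(\<Prod>i\<in>I. \<Sum>b\<in>B i. w i b * b ^ e i) = (\<Prod>i\<in>I. 1)] (mod q)"
      using True w[OF _ order_refl] by (intro cong_prod) auto
    moreover have "sum e I = sum c I" "(\<Prod>i\<in>I. falling (c i) (e i)) = (\<Prod>i\<in>I. fact (c i))"
      using True by (auto simp: falling_self intro!: sum.cong prod.cong)
    ultimately show ?thesis unfolding T
      using cong_mult[OF _ cong_refl, of "\<Prod>i\<in>I. \<Sum>b\<in>B i. w i b * b ^ e i" 1 q "\<Prod>i\<in>I. fact (c i)"]
      by simp
  next
    case False
    \<comment> \<open>Since the total of e is at most that of c, an e different from c falls short
      somewhere, and the factor there vanishes modulo q.\<close>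
    have "\<exists>i\<in>I. e i < c i"
    proof (rule ccontr)
      assume "\<not> ?thesis"
      then have "sum c I < sum e I" using False fI
        by (intro sum_strict_mono_ex1) (force simp: not_less)+
      with 0 show False by simp
    qed
    then obtain i where i: "i \<in> I" "e i < c i" by blast
    have "q dvd (\<Sum>b\<in>B i. w i b * b ^ e i)"
      using w[of i "e i"] i by (simp add: cong_0_iff)
    then have "q dvd (\<Prod>i\<in>I. \<Sum>b\<in>B i. w i b * b ^ e i)"
      using i fI by (meson dvd_prodI dvd_trans)
    then have "[(\<Prod>i\<in>I. \<Sum>b\<in>B i. w i b * b ^ e i) * (\<Prod>i\<in>I. fact (c i)) = 0] (mod q)"
      by (simp add: cong_0_iff)
    \<comment> \<open>The right side is 0 as well: with equal totals, the shortfall at i forces an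
      excess e j > c j elsewhere.\<close>
    moreover have "(\<Prod>i\<in>I. falling (c i) (e i)) = 0" if eq: "sum e I = sum c I"
    proof -
      have "\<exists>j\<in>I. c j < e j"
      proof (rule ccontr)
        assume "\<not> ?thesis"
        then have "sum e I < sum c I" using i fI
          by (intro sum_strict_mono_ex1) (force simp: not_less)+
        with eq show False by simp
      qed
      then show ?thesis using fI falling_eq_0 by auto
    qed
    ultimately show ?thesis unfolding T by simp
  qed
next
  case (Suc t)
  define F :: int where "F = (\<Prod>i\<in>I. fact (c i))"
  define P where "P = (\<Prod>i\<in>I. falling (c i) (e i))"
  define e' where "e' i = e(i := Suc (e i))" for i
  define T where "T e t = (\<Sum>x\<in>PiE I B. (\<Prod>i\<in>I. w i (x i) * x i ^ e i) * (\<Sum>i\<in>I. x i) ^ t)" for e t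
  have prod_e': "(\<Prod>j\<in>I. w j (x j) * x j ^ e' i j) = (\<Prod>j\<in>I. w j (x j) * x j ^ e j) * x i"
    if "i \<in> I" for i x
  proof -
    have "(\<Prod>j\<in>I - {i}. w j (x j) * x j ^ e' i j) = (\<Prod>j\<in>I - {i}. w j (x j) * x j ^ e j)"
      by (intro prod.cong) (auto simp: e'_def)
    then show ?thesis
      using that fI by (simp add: prod.remove[of I i] e'_def algebra_simps)
  qed
  have falling_e': "(\<Prod>j\<in>I. falling (c j) (e' i j)) = P * (int (c i) - int (e i))" if "i \<in> I" for i
  proof -
    have "(\<Prod>j\<in>I - {i}. falling (c j) (e' i j)) = (\<Prod>j\<in>I - {i}. falling (c j) (e j))"
      by (intro prod.cong) (auto simp: e'_def)
    then show ?thesis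
      using that fI by (simp add: P_def prod.remove[of I i] e'_def falling_Suc algebra_simps)
  qed
  have sum_e': "sum (e' i) I = Suc (sum e I)" if "i \<in> I" for i
  proof -
    have "sum (e' i) (I - {i}) = sum e (I - {i})"
      by (intro sum.cong) (auto simp: e'_def)
    then show ?thesis using that fI by (simp add: sum.remove[of I i] e'_def)
  qed
  \<comment> \<open>One factor of the power is multiplied out; each term x i raises one
    exponent.\<close>
  have "T e (Suc t) = (\<Sum>i\<in>I. T (e' i) t)"
  proof -
    have "T e (Suc t) = (\<Sum>x\<in>PiE I B. \<Sum>i\<in>I. (\<Prod>j\<in>I. w j (x j) * x j ^ e j) * x i * (\<Sum>i\<in>I. x i) ^ t)"
      unfolding T_def by (intro sum.cong refl) (simp add: sum_distrib_left sum_distrib_right mult_ac)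
    also have "\<dots> = (\<Sum>x\<in>PiE I B. \<Sum>i\<in>I. (\<Prod>j\<in>I. w j (x j) * x j ^ e' i j) * (\<Sum>i\<in>I. x i) ^ t)"
      by (intro sum.cong refl) (simp add: prod_e')
    also have "\<dots> = (\<Sum>i\<in>I. T (e' i) t)"
      unfolding T_def by (rule sum.swap)
    finally show ?thesis .
  qed
  then have "T e (Suc t) * F = (\<Sum>i\<in>I. T (e' i) t * F)"
    by (simp add: sum_distrib_right)
  also have "[\<dots> = (\<Sum>i\<in>I. if Suc t + sum e I = sum c I
      then fact t * (P * (int (c i) - int (e i))) else 0)] (mod q)"
  proof (rule cong_sum)
    fix i assume i: "i \<in> I"
    have "t + sum (e' i) I \<le> sum c I" using Suc.prems sum_e'[OF i] by simp
    from Suc.IH[OF this] show "[T (e' i) t * F = (if Suc t + sum e I = sum c I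
      then fact t * (P * (int (c i) - int (e i))) else 0)] (mod q)"
      unfolding T_def F_def sum_e'[OF i] falling_e'[OF i] by simp
  qed
  also have "(\<Sum>i\<in>I. if Suc t + sum e I = sum c I
      then fact t * (P * (int (c i) - int (e i))) else 0)
    = (if Suc t + sum e I = sum c I then fact (Suc t) * P else 0)"
  proof (cases "Suc t + sum e I = sum c I")
    case True
    \<comment> \<open>The factors c i - e i gained by raising exponents add up to t + 1, which turns
      t! into (t + 1)!.\<close>
    have "(\<Sum>i\<in>I. int (c i) - int (e i)) = int (sum c I) - int (sum e I)"
      by (simp add: sum_subtractf)
    also have "\<dots> = int (Suc t)" unfolding True[symmetric] by simp
    finally have "(\<Sum>i\<in>I. fact t * (P * (int (c i) - int (e i)))) = fact t * (P * int (Suc t))"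
      by (simp only: sum_distrib_left[symmetric])
    with True show ?thesis by (simp add: algebra_simps)
  qed simp
  finally show ?case unfolding T_def F_def P_def .
qed

text \<open>\<open>\<alpha>\<close> and \<open>ex\<close> encode a polynomial G, homogeneous of
  degree sum c I - N. Multiplied by a monic polynomial of degree N in the sum of the x i that
  vanishes on R, it is 0 modulo p on the whole grid. The extracted coefficient, times the product of
  the c i!, is N! times the sum in the conclusion, and N < p lets N! cancel.\<close>

lemma coefficient_dvd_if_sums_covered:
  fixes p N :: nat and B :: "'i \<Rightarrow> int set" and \<alpha> :: "'e \<Rightarrow> int" and ex :: "'e \<Rightarrow> 'i \<Rightarrow> nat"
  assumes p: "prime p" and fI: "finite I"
    and B: "\<And>i. i \<in> I \<Longrightarrow> B i \<subseteq> {0..<int p}" "\<And>i. i \<in> I \<Longrightarrow> card (B i) = Suc (c i)"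
    and deg: "\<And>e. e \<in> E \<Longrightarrow> N + sum (ex e) I = sum c I"
    and N: "N < p" and R: "finite R" "card R \<le> N"
    and vanish: "\<And>x. x \<in> PiE I B \<Longrightarrow>
      (\<Sum>e\<in>E. \<alpha> e * (\<Prod>i\<in>I. x i ^ ex e i)) = 0 \<or> (\<Sum>i\<in>I. x i) mod int p \<in> R"
  shows "int p dvd (\<Sum>e\<in>E. \<alpha> e * (\<Prod>i\<in>I. falling (c i) (ex e i)))"
proof -
  have fB: "finite (B i)" if "i \<in> I" for i
    using B(2)[OF that] by (simp add: card_ge_0_finite)
  have "\<forall>i\<in>I. \<exists>w. \<forall>j\<le>c i. [(\<Sum>b\<in>B i. w b * b ^ j) = (if j = c i then 1 else 0)] (mod int p)"
    using interpolation_weights[OF p B] by blast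
  then obtain w where w: "\<And>i j. i \<in> I \<Longrightarrow> j \<le> c i \<Longrightarrow>
      [(\<Sum>b\<in>B i. w i b * b ^ j) = (if j = c i then 1 else 0)] (mod int p)" by metis
  \<comment> \<open>The power of the variable pads the degree to exactly \<open>N\<close>.\<close>
  define Q where "Q = monom (1::int) (N - card R) * (\<Prod>s\<in>R. [:- s, 1:])"
  have degP: "degree (\<Prod>s\<in>R. [:- s, 1::int:]) = card R"
    by (subst degree_prod_sum_eq) auto
  have nz: "(\<Prod>s\<in>R. [:- s, 1::int:]) \<noteq> 0" using R by auto
  have degQ: "degree Q = N"
    unfolding Q_def using R nz by (subst degree_mult_eq) (auto simp: degP Polynomial.degree_monom_eq)
  have "lead_coeff Q = 1"
    unfolding Q_def lead_coeff_mult lead_coeff_prod by (simp add: Polynomial.degree_monom_eq)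
  then have lcQ: "coeff Q N = 1" using degQ by simp
  have Q_dvd: "int p dvd poly Q y" if "y mod int p \<in> R" for y
  proof -
    have "int p dvd y - y mod int p" by (simp add: minus_mod_eq_mult_div)
    moreover have "y - y mod int p dvd (\<Prod>s\<in>R. y - s)"
      using that R by (meson dvd_prodI)
    ultimately show ?thesis
      by (auto simp: Q_def poly_prod intro!: dvd_mult intro: dvd_trans)
  qed
  define W where "W x = (\<Prod>i\<in>I. w i (x i))" for x
  define G where "G x = (\<Sum>e\<in>E. \<alpha> e * (\<Prod>i\<in>I. x i ^ ex e i))" for x :: "'i \<Rightarrow> int"
  define T where "T e t = (\<Sum>x\<in>PiE I B. (\<Prod>i\<in>I. w i (x i) * x i ^ ex e i) * (\<Sum>i\<in>I. x i) ^ t)" for e t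
  define F :: int where "F = (\<Prod>i\<in>I. fact (c i))"
  define D where "D e = (\<Prod>i\<in>I. falling (c i) (ex e i))" for e
  \<comment> \<open>Powers t < N leave the total degree below sum c I and contribute 0.\<close>
  have T: "[T e t * F = (if t = N then fact N * D e else 0)] (mod int p)" if "e \<in> E" "t \<le> N" for e t
  proof -
    have "t + sum (ex e) I \<le> sum c I" using deg[OF that(1)] that(2) by simp
    then have "[T e t * F = (if t + sum (ex e) I = sum c I then fact t * D e else 0)] (mod int p)"
      unfolding T_def F_def D_def by (intro weighted_monomial_sum[OF fI]) (use fB w in blast)+
    moreover have "t + sum (ex e) I = sum c I \<longleftrightarrow> t = N" using deg[OF that(1)] by linarith
    ultimately show ?thesis by auto
  qed
  have "int p dvd (\<Sum>x\<in>PiE I B. W x * (G x * poly Q (\<Sum>i\<in>I. x i)))"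
  proof (rule dvd_sum, rule dvd_mult)
    fix x assume "x \<in> PiE I B"
    from vanish[OF this] show "int p dvd G x * poly Q (\<Sum>i\<in>I. x i)"
      using Q_dvd by (auto simp: G_def)
  qed
  also have "(\<Sum>x\<in>PiE I B. W x * (G x * poly Q (\<Sum>i\<in>I. x i)))
    = (\<Sum>x\<in>PiE I B. \<Sum>e\<in>E. \<Sum>t\<le>N. \<alpha> e * (coeff Q t * ((\<Prod>i\<in>I. w i (x i) * x i ^ ex e i) * (\<Sum>i\<in>I. x i) ^ t)))"
    unfolding G_def W_def poly_altdef degQ
    by (intro sum.cong refl)
       (simp add: sum_distrib_left sum_distrib_right prod.distrib mult_ac)
  also have "\<dots> = (\<Sum>e\<in>E. \<Sum>t\<le>N. \<alpha> e * (coeff Q t * T e t))"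
    unfolding T_def sum_distrib_left
    by (subst sum.swap, rule sum.cong[OF refl], rule sum.swap)
  finally have "int p dvd (\<Sum>e\<in>E. \<Sum>t\<le>N. \<alpha> e * (coeff Q t * T e t)) * F"
    by simp
  also have "(\<Sum>e\<in>E. \<Sum>t\<le>N. \<alpha> e * (coeff Q t * T e t)) * F
    = (\<Sum>e\<in>E. \<Sum>t\<le>N. \<alpha> e * (coeff Q t * (T e t * F)))"
    by (simp add: sum_distrib_left sum_distrib_right mult_ac)
  finally have dvd: "int p dvd \<dots>" .
  have "[(\<Sum>e\<in>E. \<Sum>t\<le>N. \<alpha> e * (coeff Q t * (T e t * F)))
    = (\<Sum>e\<in>E. \<Sum>t\<le>N. \<alpha> e * (coeff Q t * (if t = N then fact N * D e else 0)))] (mod int p)"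
    by (intro cong_sum cong_mult cong_refl T) auto
  also have "(\<Sum>e\<in>E. \<Sum>t\<le>N. \<alpha> e * (coeff Q t * (if t = N then fact N * D e else 0)))
    = (\<Sum>e\<in>E. \<alpha> e * (fact N * D e))"
    by (intro sum.cong refl) (simp add: if_distrib lcQ cong: if_cong)
  also have "\<dots> = fact N * (\<Sum>e\<in>E. \<alpha> e * D e)"
    by (simp add: sum_distrib_left mult_ac)
  finally have "int p dvd fact N * (\<Sum>e\<in>E. \<alpha> e * D e)"
    using dvd cong_dvd_iff by blast
  moreover have "\<not> int p dvd fact N"
    using N prime_dvd_fact_iff[OF p] by (metis int_dvd_int_iff of_nat_fact not_less)
  ultimately show ?thesis
    unfolding D_def using p by (simp add: prime_dvd_mult_iff)
qed

section \<open>The Cauchy-Davenport theorem\<close>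

text \<open>Greedy filling; it serves to shrink the sets until the degrees add up to exactly
  N.\<close>

lemma exists_bounded_with_sum:
  fixes d :: "'i \<Rightarrow> nat"
  assumes "finite I" "N \<le> sum d I"
  shows "\<exists>c. (\<forall>i\<in>I. c i \<le> d i) \<and> sum c I = N"
  using assms
proof (induction I arbitrary: N rule: finite_induct)
  case (insert i I)
  then have "N - min N (d i) \<le> sum d I" by auto
  from insert.IH[OF this] obtain c where c: "\<forall>i\<in>I. c i \<le> d i" "sum c I = N - min N (d i)" by blast
  have "sum (c(i := min N (d i))) I = sum c I"
    using insert by (intro sum.cong) auto
  with c insert show ?case
    by (intro exI[of _ "c(i := min N (d i))"]) auto
qed auto

text \<open>\<open>N\<close> is the bound minus one: if the claim fails, the set of sums is itself a
  cover \<open>R\<close> of size at most N.\<close>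

theorem cauchy_davenport_family:
  fixes p N :: nat and X :: "'i \<Rightarrow> int set"
  assumes p: "prime p" and fI: "finite I"
    and X: "\<And>i. i \<in> I \<Longrightarrow> X i \<subseteq> {0..<int p}" "\<And>i. i \<in> I \<Longrightarrow> X i \<noteq> {}"
    and N: "N \<le> (\<Sum>i\<in>I. card (X i) - 1)" "N < p"
  shows "N < card ((\<lambda>x. (\<Sum>i\<in>I. x i) mod int p) ` PiE I X)"
proof (rule ccontr)
  assume neg: "\<not> ?thesis"
  obtain c where c: "\<And>i. i \<in> I \<Longrightarrow> c i \<le> card (X i) - 1" "sum c I = N"
    using exists_bounded_with_sum[OF fI N(1)] by blast
  have fX: "finite (X i)" if "i \<in> I" for i
    using X(1)[OF that] finite_subset by blast
  have "\<forall>i\<in>I. \<exists>B. B \<subseteq> X i \<and> card B = Suc (c i)"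
  proof
    fix i assume i: "i \<in> I"
    \<comment> \<open>For an empty set the truncated card - 1 would be 0 and leave no room for c i +
      1 elements.\<close>
    have "card (X i) > 0" using X(2)[OF i] fX[OF i] by (simp add: card_gt_0_iff)
    then have "Suc (c i) \<le> card (X i)" using c(1)[OF i] by linarith
    then show "\<exists>B. B \<subseteq> X i \<and> card B = Suc (c i)" by (meson obtain_subset_with_card_n)
  qed
  then obtain B where B: "\<And>i. i \<in> I \<Longrightarrow> B i \<subseteq> X i" "\<And>i. i \<in> I \<Longrightarrow> card (B i) = Suc (c i)"
    by metis
  \<comment> \<open>G = 1 is a single term with all exponents 0, so this says that p divides
    1.\<close>
  have "int p dvd (\<Sum>e\<in>{()}. 1 * (\<Prod>i\<in>I. falling (c i) ((\<lambda>_ _. 0) e i)))"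
  proof (rule coefficient_dvd_if_sums_covered[OF p fI _ B(2)])
    show "finite ((\<lambda>x. (\<Sum>i\<in>I. x i) mod int p) ` PiE I X)"
      using fI fX by (intro finite_imageI finite_PiE) auto
    show "card ((\<lambda>x. (\<Sum>i\<in>I. x i) mod int p) ` PiE I X) \<le> N" using neg by simp
    show "B i \<subseteq> {0..<int p}" if "i \<in> I" for i using B(1) X(1) that by blast
    fix x assume "x \<in> PiE I B"
    then have "x \<in> PiE I X" using PiE_mono[of I B X] B(1) by blast
    then show "(\<Sum>e\<in>{()}. 1 * (\<Prod>i\<in>I. x i ^ 0)) = 0
      \<or> (\<Sum>i\<in>I. x i) mod int p \<in> (\<lambda>x. (\<Sum>i\<in>I. x i) mod int p) ` PiE I X" by blast
  qed (use c N in auto)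
  then show False using p by (auto simp: prime_nat_iff)
qed

section \<open>Vandermonde determinants in falling factorials\<close>

text \<open>
  In the Newton basis at the nodes \<open>c 0, c 1, \<dots>\<close> the evaluation matrix is lower triangular and the
  change of basis from the falling factorials is unitriangular.
\<close>
lemma falling_newton_expansion:
  fixes x :: "nat \<Rightarrow> int"
  shows "\<exists>u. u j = 1 \<and> (\<forall>l>j. u l = 0) \<and>
    (\<forall>n. falling n j = (\<Sum>l\<le>j. (\<Prod>t<l. int n - x t) * u l))"
proof (induction j)
  case 0
  show ?case by (intro exI[of _ "\<lambda>l. if l = 0 then 1 else 0"]) auto
next
  case (Suc j)
  then obtain u where u: "u j = 1" "\<And>l. l > j \<Longrightarrow> u l = 0"
    "\<And>n. falling n j = (\<Sum>l\<le>j. (\<Prod>t<l. int n - x t) * u l)" by blast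
  \<comment> \<open>From n - j = (n - x l) + (x l - j): the first part moves to the next Newton
    polynomial, the second keeps the index.\<close>
  define v where "v l = (if l = 0 then 0 else u (l - 1)) + (x l - int j) * u l" for l
  have "falling n (Suc j) = (\<Sum>l\<le>Suc j. (\<Prod>t<l. int n - x t) * v l)" for n
  proof -
    let ?N = "\<lambda>l. \<Prod>t<l. int n - x t"
    have "falling n (Suc j) = (\<Sum>l\<le>j. ?N (Suc l) * u l + ?N l * ((x l - int j) * u l))"
      unfolding falling_Suc u(3) sum_distrib_right by (intro sum.cong) (auto simp: algebra_simps)
    also have "\<dots> = (\<Sum>l\<le>j. ?N (Suc l) * u l) + (\<Sum>l\<le>Suc j. ?N l * ((x l - int j) * u l))"
      using u(2) by (simp add: sum.distrib)
    also have "(\<Sum>l\<le>j. ?N (Suc l) * u l) = (\<Sum>l\<le>Suc j. ?N l * (if l = 0 then 0 else u (l - 1)))"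
      by (subst sum.atMost_Suc_shift) simp
    also have "\<dots> + (\<Sum>l\<le>Suc j. ?N l * ((x l - int j) * u l)) = (\<Sum>l\<le>Suc j. ?N l * v l)"
      unfolding v_def by (simp only: sum.distrib[symmetric] distrib_left)
    finally show ?thesis .
  qed
  then show ?case using u(1,2) by (intro exI[of _ v]) (auto simp: v_def)
qed

text \<open>The Vandermonde value, because falling factorials are monic of degree j. It is the
  coefficient extracted for sums of distinct elements.\<close>

lemma det_falling:
  fixes c :: "nat \<Rightarrow> nat"
  shows "det (mat n n (\<lambda>(i, j). falling (c i) j)) = (\<Prod>i<n. \<Prod>t<i. int (c i) - int (c t))"
proof -
  obtain u where u: "\<And>j. u j j = 1" "\<And>j l. l > j \<Longrightarrow> u j l = 0"
    "\<And>j n. falling n j = (\<Sum>l\<le>j. (\<Prod>t<l. int n - int (c t)) * u j l)"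
    using falling_newton_expansion[of _ "\<lambda>t. int (c t)"] by metis
  define L where "L = mat n n (\<lambda>(i, l). \<Prod>t<l. int (c i) - int (c t))"
  define U where "U = mat n n (\<lambda>(l, j). u j l)"
  have L: "L \<in> carrier_mat n n" and U: "U \<in> carrier_mat n n" by (auto simp: L_def U_def)
  have "mat n n (\<lambda>(i, j). falling (c i) j) = L * U"
  proof (rule eq_matI)
    fix i j assume "i < dim_row (L * U)" "j < dim_col (L * U)"
    then have ij: "i < n" "j < n" by (auto simp: L_def U_def)
    have "(L * U) $$ (i, j) = (\<Sum>l\<in>{0..<n}. (\<Prod>t<l. int (c i) - int (c t)) * u j l)"
      using ij by (simp add: L_def U_def scalar_prod_def)
    also have "\<dots> = (\<Sum>l\<le>j. (\<Prod>t<l. int (c i) - int (c t)) * u j l)"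
      using ij u(2) by (intro sum.mono_neutral_right) auto
    finally show "mat n n (\<lambda>(i, j). falling (c i) j) $$ (i, j) = (L * U) $$ (i, j)"
      using ij u(3) by simp
  qed (auto simp: L_def U_def)
  then have "det (mat n n (\<lambda>(i, j). falling (c i) j)) = det L * det U"
    using det_mult[OF L U] by simp
  also have "det U = 1"
    using det_upper_triangular[OF _ U] u by (simp add: prod_list_diag_prod U_def upper_triangular_def)
  also have "det L = (\<Prod>i<n. \<Prod>t<i. int (c i) - int (c t))"
  proof -
    \<comment> \<open>Above the diagonal, i < l, the product contains the zero factor at t =
      i.\<close>
    have "det L = prod_list (diag_mat L)"
      by (rule det_lower_triangular[OF _ L]) (auto simp: L_def)
    then show ?thesis by (simp add: prod_list_diag_prod L_def lessThan_atLeast0)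
  qed
  finally show ?thesis by simp
qed

section \<open>The Dias da Silva-Hamidoune theorem\<close>

text \<open>Raise the staircase c i = i by N units spread evenly: N div m everywhere and one more on
  the last N mod m positions, so that c stays strictly increasing.\<close>

lemma exists_staircase_with_sum:
  fixes N m K :: nat
  assumes "N \<le> m * K"
  shows "\<exists>c. (\<forall>i<m. c i \<le> i + K) \<and> (\<forall>i<m. \<forall>t<i. c t < c i) \<and> sum c {0..<m} = N + \<Sum>{0..<m}"
proof (cases "m = 0")
  case False
  define s where "s = N mod m"
  define c where "c i = i + (N div m + (if m - s \<le> i then 1 else 0))" for i
  have s: "s < m" using False by (simp add: s_def)
  have "sum c {0..<m} = \<Sum>{0..<m} + (m * (N div m) + (\<Sum>i\<in>{0..<m}. if m - s \<le> i then 1 else 0))"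
    unfolding c_def by (simp add: sum.distrib)
  also have "(\<Sum>i\<in>{0..<m}. if m - s \<le> i then 1 else 0) = card {m - s..<m}"
    unfolding card_eq_sum by (rule sum.mono_neutral_cong_right) auto
  also have "m * (N div m) + card {m - s..<m} = N"
    using s by (simp add: s_def)
  finally have "sum c {0..<m} = N + \<Sum>{0..<m}" by simp
  moreover have "c i \<le> i + K" if "i < m" for i
  proof (cases "s = 0")
    case True
    with that have "c i = i + N div m" by (simp add: c_def)
    also have "N div m \<le> K" using div_le_mono[OF assms, of m] False by simp
    finally show ?thesis by simp
  next
    case s0: False
    \<comment> \<open>A nonzero remainder gives N div m < K, which leaves room for the extra
      unit.\<close>
    have "m * (N div m) + s = N" by (simp add: s_def)
    then have "m * (N div m) < m * K" using s0 assms by linarith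
    then show ?thesis by (simp add: c_def)
  qed
  moreover have "\<forall>i<m. \<forall>t<i. c t < c i" by (auto simp: c_def)
  ultimately show ?thesis by blast
qed (use assms in auto)

text \<open>The Vandermonde factor vanishes at points with a repeated coordinate, so only sums of m
  distinct elements have to be covered. Strict growth of c keeps the coefficient nonzero modulo
  p.\<close>

theorem dias_da_silva_hamidoune:
  fixes p N k m :: nat and A :: "int set"
  assumes p: "prime p" and A: "A \<subseteq> {0..<int p}" "card A = k"
    and N: "m \<le> k" "N \<le> m * (k - m)" "N < p"
  shows "N < card ((\<lambda>B. \<Sum>B mod int p) ` {B. B \<subseteq> A \<and> card B = m})"
proof (rule ccontr)
  let ?R = "(\<lambda>B. \<Sum>B mod int p) ` {B. B \<subseteq> A \<and> card B = m}"
  assume neg: "\<not> ?thesis"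
  have fA: "finite A" using A finite_subset by blast
  obtain c where c: "\<And>i. i < m \<Longrightarrow> c i \<le> i + (k - m)" "\<And>i t. i < m \<Longrightarrow> t < i \<Longrightarrow> c t < c i"
    "sum c {0..<m} = N + \<Sum>{0..<m}"
    using exists_staircase_with_sum[OF N(2)] by blast
  have ck: "c i < k" if "i < m" for i
    using c(1)[OF that] that N(1) by linarith
  have kp: "k \<le> p" using card_mono[OF _ A(1)] A(2) by simp
  have "\<forall>i\<in>{0..<m}. \<exists>B. B \<subseteq> A \<and> card B = Suc (c i)"
    using ck A(2) by (metis Suc_leI atLeastLessThan_iff obtain_subset_with_card_n)
  then obtain B where B: "\<And>i. i \<in> {0..<m} \<Longrightarrow> B i \<subseteq> A" "\<And>i. i \<in> {0..<m} \<Longrightarrow> card (B i) = Suc (c i)"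
    by metis
  \<comment> \<open>The exponent vectors are the permutations of 0..m-1; their common total is
    exactly the surplus of sum c over N.\<close>
  have "int p dvd (\<Sum>\<pi>\<in>{\<pi>. \<pi> permutes {0..<m}}. signof \<pi> * (\<Prod>i\<in>{0..<m}. falling (c i) (\<pi> i)))"
  proof (rule coefficient_dvd_if_sums_covered[OF p _ _ B(2)])
    show "finite ?R" using fA by simp
    show "card ?R \<le> N" using neg by simp
    show "B i \<subseteq> {0..<int p}" if "i \<in> {0..<m}" for i using B(1) A(1) that by blast
    show "N + sum \<pi> {0..<m} = sum c {0..<m}" if "\<pi> \<in> {\<pi>. \<pi> permutes {0..<m}}" for \<pi>
      using that sum.permute[of \<pi> "{0..<m}" id] c(3) by simp
    fix x assume x: "x \<in> PiE {0..<m} B"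
    show "(\<Sum>\<pi>\<in>{\<pi>. \<pi> permutes {0..<m}}. signof \<pi> * (\<Prod>i\<in>{0..<m}. x i ^ \<pi> i)) = 0
      \<or> (\<Sum>i\<in>{0..<m}. x i) mod int p \<in> ?R"
    proof (cases "inj_on x {0..<m}")
      case True
      have "x ` {0..<m} \<subseteq> A" using B(1) PiE_mem[OF x] by blast
      moreover have "card (x ` {0..<m}) = m" "\<Sum>(x ` {0..<m}) = (\<Sum>i\<in>{0..<m}. x i)"
        using True by (auto simp: card_image sum.reindex)
      ultimately have "(\<Sum>i\<in>{0..<m}. x i) mod int p \<in> ?R"
        by (intro image_eqI[where x = "x ` {0..<m}"]) simp_all
      then show ?thesis ..
    next
      case False
      then obtain i j where ij: "i < m" "j < m" "i \<noteq> j" "x i = x j"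
        by (auto simp: inj_on_def)
      let ?V = "mat m m (\<lambda>(i, j). x i ^ j)"
      have "det ?V = 0"
        by (rule det_identical_rows[of _ m i j]) (use ij in \<open>auto intro!: eq_vecI\<close>)
      also have "det ?V = (\<Sum>\<pi>\<in>{\<pi>. \<pi> permutes {0..<m}}. signof \<pi> * (\<Prod>i\<in>{0..<m}. x i ^ \<pi> i))"
        by (subst det_def'[of _ m]) (auto intro!: sum.cong prod.cong simp: permutes_in_image)
      finally show ?thesis by simp
    qed
  qed (use N in auto)
  also have "(\<Sum>\<pi>\<in>{\<pi>. \<pi> permutes {0..<m}}. signof \<pi> * (\<Prod>i\<in>{0..<m}. falling (c i) (\<pi> i)))
    = det (mat m m (\<lambda>(i, j). falling (c i) j))"
    by (subst det_def'[of _ m]) (auto intro!: sum.cong prod.cong simp: permutes_in_image)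
  also have "\<dots> = (\<Prod>i<m. \<Prod>t<i. int (c i) - int (c t))"
    by (rule det_falling)
  \<comment> \<open>A zero coefficient would need two values of c congruent modulo p, but they are
    distinct and below k \<le> p.\<close>
  finally obtain i t where it: "i < m" "t < i" "int p dvd int (c i) - int (c t)"
    using p by (auto simp: prime_dvd_prod_iff)
  then have "int p \<le> int (c i) - int (c t)"
    using c(2)[of i t] by (intro zdvd_imp_le) auto
  then show False using ck[OF it(1)] kp by simp
qed

section \<open>Sumsets with bounded multiplicity in Z/pZ\<close>

lemma gen_sumset_residue_ring:
  fixes p :: nat
  assumes p: "1 < p" and A: "A \<subseteq> carrier (residue_ring (int p))"
  shows "gen_sumset (residue_ring (int p)) h r A =
    {(\<Sum>a\<in>A. int (c a) * a) mod int p | c. (\<forall>a\<in>A. c a \<le> r) \<and> (\<Sum>a\<in>A. c a) = h}"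
proof -
  interpret residues "int p" "residue_ring (int p)"
    by unfold_locales (use p in auto)
  let ?R = "residue_ring (int p)"
  have fA: "finite A" using A finite_subset finite by blast
  have pow: "[n] \<cdot>\<^bsub>?R\<^esub> a = (int n * a) mod int p" if "a \<in> carrier ?R" for n :: nat and a
    using that by (induction n) (auto simp: res_zero_eq res_add_eq algebra_simps mod_simps)
  have "(\<Oplus>\<^bsub>?R\<^esub>a\<in>A. [c a] \<cdot>\<^bsub>?R\<^esub> a) = (\<Sum>a\<in>A. int (c a) * a) mod int p" for c :: "int \<Rightarrow> nat"
    using fA A
    by (induction A rule: finite_induct)
       (auto simp: res_zero_eq res_add_eq pow mod_simps subset_iff finsum_insert Pi_iff)
  then show ?thesis unfolding gen_sumset_def by simp
qed

theorem theorem2: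
  fixes p h r m \<epsilon> k :: nat and A :: "int set"
  assumes "prime p"
    and "h = m * r + \<epsilon>" and "\<epsilon> < r"
    and "A \<subseteq> carrier (residue_ring (int p))" and "A \<noteq> {}" and "card A = k"
    and "1 \<le> r" and "r \<le> h" and "h \<le> r * k"
  shows "int (card (gen_sumset (residue_ring (int p)) h r A)) \<ge>
    min (int p)
      (int h * int k - (int m)\<^sup>2 * int r + 1 - 2 * int m * int \<epsilon> - int \<epsilon>)"
proof -
  have p1: "1 < p" using assms(1) prime_gt_1_nat by blast
  have A: "A \<subseteq> {0..<int p}" using assms(4) by (auto simp: residue_ring_def)
  have fA: "finite A" using A finite_subset by blast
  define n where "n i = (if i < \<epsilon> then Suc m else m)" for i
  \<comment> \<open>Used over \<open>nat\<close> for the total h and over \<open>int\<close> for the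
    bound.\<close>
  have sum_n: "(\<Sum>i<r. g (n i)) = of_nat \<epsilon> * g (Suc m) + of_nat (r - \<epsilon>) * g m"
    for g :: "nat \<Rightarrow> 'a::comm_semiring_1"
  proof -
    have "(\<Sum>i<r. g (n i)) = (\<Sum>i<\<epsilon>. g (n i)) + (\<Sum>i\<in>{\<epsilon>..<r}. g (n i))"
      using assms(3) sum.atLeastLessThan_concat[of 0 \<epsilon> r "\<lambda>i. g (n i)"]
      by (simp add: lessThan_atLeast0)
    also have "\<dots> = (\<Sum>i<\<epsilon>. g (Suc m)) + (\<Sum>i\<in>{\<epsilon>..<r}. g m)"
      by (intro arg_cong2[of _ _ _ _ "(+)"] sum.cong) (auto simp: n_def)
    finally show ?thesis by simp
  qed
  have sum_n_h: "(\<Sum>i<r. n i) = h"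
    using sum_n[of "\<lambda>x. x"] assms(2,3) by (simp add: algebra_simps diff_mult_distrib)
  have nk: "n i \<le> k" for i
  proof -
    \<comment> \<open>If \<epsilon> > 0 the inequality is strict, which leaves room for subsets of
      size m + 1.\<close>
    have "m * r \<le> r * k" using assms by linarith
    then have "m \<le> k" using assms(7) by (simp add: mult.commute)
    moreover have "m < k" if "0 < \<epsilon>"
    proof -
      have "m * r < r * k" using assms that by linarith
      then show ?thesis by (simp add: mult.commute)
    qed
    ultimately show ?thesis by (auto simp: n_def)
  qed
  define X where "X i = (\<lambda>B. \<Sum>B mod int p) ` {B. B \<subseteq> A \<and> card B = n i}" for i
  have cardX: "min (p - 1) (n i * (k - n i)) < card (X i)" for i
    unfolding X_def
    by (rule dias_da_silva_hamidoune[OF assms(1) A assms(6) nk]) (use p1 in auto)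
  \<comment> \<open>N + 1 is the claimed bound, capped at p.\<close>
  define N where "N = min (p - 1) (\<Sum>i<r. n i * (k - n i))"
  have "N < card ((\<lambda>x. (\<Sum>i\<in>{..<r}. x i) mod int p) ` PiE {..<r} X)"
  proof (rule cauchy_davenport_family[OF assms(1)])
    show "X i \<subseteq> {0..<int p}" for i using p1 by (auto simp: X_def)
    show "X i \<noteq> {}" for i using cardX[of i] by auto
    show "N < p" using p1 by (auto simp: N_def)
    have le: "min (p - 1) (n i * (k - n i)) \<le> card (X i) - 1" for i
      using cardX[of i] by linarith
    show "N \<le> (\<Sum>i<r. card (X i) - 1)"
    \<comment> \<open>Either one set \<open>X i\<close> already reaches the cap, or no minimum is
      truncated and the bounds add up.\<close>
    proof (cases "\<exists>i<r. p - 1 \<le> n i * (k - n i)")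
      case True
      then obtain i where i: "i < r" "p - 1 \<le> n i * (k - n i)" by blast
      have "N \<le> p - 1" by (simp add: N_def)
      also have "\<dots> \<le> card (X i) - 1" using le[of i] i(2) by simp
      also have "\<dots> \<le> (\<Sum>i<r. card (X i) - 1)"
        using i(1) by (intro member_le_sum) auto
      finally show ?thesis .
    next
      case False
      have "N \<le> (\<Sum>i<r. n i * (k - n i))" by (simp add: N_def)
      also have "\<dots> \<le> (\<Sum>i<r. card (X i) - 1)"
      proof (rule sum_mono)
        fix i assume "i \<in> {..<r}"
        with False show "n i * (k - n i) \<le> card (X i) - 1" using le[of i] by (auto simp: not_le min_def)
      qed
      finally show ?thesis .
    qed
  qed simp
  also have "\<dots> \<le> card (gen_sumset (residue_ring (int p)) h r A)"
  proof (rule card_mono)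
    have "gen_sumset (residue_ring (int p)) h r A \<subseteq> {0..<int p}"
      unfolding gen_sumset_residue_ring[OF p1 assms(4)] using p1 by auto
    then show "finite (gen_sumset (residue_ring (int p)) h r A)" using finite_subset by blast
    show "(\<lambda>x. (\<Sum>i\<in>{..<r}. x i) mod int p) ` PiE {..<r} X \<subseteq> gen_sumset (residue_ring (int p)) h r A"
    proof (rule image_subsetI)
      fix x assume "x \<in> PiE {..<r} X"
      then have "\<forall>i\<in>{..<r}. \<exists>B. B \<subseteq> A \<and> card B = n i \<and> x i = \<Sum>B mod int p"
        unfolding X_def PiE_iff by blast
      then obtain B where B: "\<And>i. i < r \<Longrightarrow> B i \<subseteq> A" "\<And>i. i < r \<Longrightarrow> card (B i) = n i"
        "\<And>i. i < r \<Longrightarrow> x i = \<Sum>(B i) mod int p"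
        by (metis lessThan_iff)
      \<comment> \<open>The multiplicity of a is the number of chosen subsets containing it, hence
        at most r; double counting gives the total h and the same sum.\<close>
      define c where "c a = (\<Sum>i<r. if a \<in> B i then 1 else 0::nat)" for a
      have c_le: "c a \<le> r" for a
        using sum_mono[of "{..<r}" "\<lambda>i. if a \<in> B i then 1 else 0::nat" "\<lambda>_. 1"] by (auto simp: c_def)
      have restrict: "(\<Sum>a\<in>A. if a \<in> B i then g a else 0) = sum g (B i)" if "i < r"
        for i and g :: "int \<Rightarrow> 'a::comm_monoid_add"
        using sum.inter_restrict[OF fA, of g "B i"] B(1)[OF that] by (simp add: Int_absorb1)
      have "(\<Sum>a\<in>A. c a) = (\<Sum>i<r. \<Sum>a\<in>A. if a \<in> B i then 1 else 0)"
        unfolding c_def by (rule sum.swap)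
      also have "\<dots> = (\<Sum>i<r. n i)"
        by (rule sum.cong) (auto simp: restrict B(2))
      finally have c_sum: "(\<Sum>a\<in>A. c a) = h" using sum_n_h by simp
      have "(\<Sum>a\<in>A. int (c a) * a) = (\<Sum>a\<in>A. \<Sum>i<r. if a \<in> B i then a else 0)"
        unfolding c_def of_nat_sum sum_distrib_right by (intro sum.cong) auto
      also have "\<dots> = (\<Sum>i<r. \<Sum>a\<in>A. if a \<in> B i then a else 0)"
        by (rule sum.swap)
      also have "\<dots> = (\<Sum>i<r. \<Sum>(B i))"
        by (rule sum.cong) (auto simp: restrict)
      finally have "(\<Sum>a\<in>A. int (c a) * a) mod int p = (\<Sum>i<r. \<Sum>(B i) mod int p) mod int p"
        by (simp add: mod_sum_eq)
      also have "(\<Sum>i<r. \<Sum>(B i) mod int p) = (\<Sum>i<r. x i)"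
        using B(3) by simp
      finally show "(\<Sum>i\<in>{..<r}. x i) mod int p \<in> gen_sumset (residue_ring (int p)) h r A"
        unfolding gen_sumset_residue_ring[OF p1 assms(4)] using c_le c_sum
        by (intro CollectI exI[of _ c]) auto
    qed
  qed
  finally have "N < card (gen_sumset (residue_ring (int p)) h r A)" .
  moreover have "int (\<Sum>i<r. n i * (k - n i))
    = int h * int k - (int m)\<^sup>2 * int r - 2 * int m * int \<epsilon> - int \<epsilon>"
  proof -
    \<comment> \<open>\<open>nk\<close> makes the natural subtraction exact.\<close>
    have "int (\<Sum>i<r. n i * (k - n i)) = (\<Sum>i<r. (\<lambda>y. int y * (int k - int y)) (n i))"
      using nk by (simp add: of_nat_diff)
    also have "\<dots> = int \<epsilon> * (int (Suc m) * (int k - int (Suc m)))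
        + (int r - int \<epsilon>) * (int m * (int k - int m))"
      using sum_n[of "\<lambda>y. int y * (int k - int y)"] assms(3) by (simp add: of_nat_diff)
    also have "\<dots> = int h * int k - (int m)\<^sup>2 * int r - 2 * int m * int \<epsilon> - int \<epsilon>"
      unfolding assms(2) by (simp add: algebra_simps power2_eq_square)
    finally show ?thesis .
  qed
  ultimately show ?thesis using p1 unfolding N_def by linarith
qed

end
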